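(* Let arteries $m$ (main street) and $c$ (cross street) meet at a junction $i$, with signal $S_{mj}$ on $m$ and signal $S_{ck}$ on $c$ at that junction. Suppose the left turn phase at $S_{mj}$ follows one of the four patterns $p_m\in\{1,2,3,4\}$, encoded by binary values $(\delta_{mj},\overline{\delta}_{mj})$, and the left turn phase at $S_{ck}$ follows one of the four patterns $p_c\in\{1,2,3,4\}$, encoded by $(\delta_{ck},\overline{\delta}_{ck})$. Then, for all $16$ possible choices of $(p_m,p_c)$, the intranode offset is $$\Psi_{S_{mj},S_{ck}}^i=\frac{1}{2}-\frac{1}{2}\left[(2\overline{\delta}_{ck}-1)\overline{\ell}_{ck}-(2\overline{\delta}_{mj}-1)\overline{\ell}_{mj}\right].$$
   Context: All times are measured in periods, where the (common) signal period has length $1$; signals behave periodically in time with period $1$. Each artery $a$ is a two-way street with an outbound and an inbound direction. Left turn patterns. For a signal $S_{ai}$ on artery $a$, $\ell_{ai}\ge 0$ and $\overline{\ell}_{ai}\ge 0$ are the durations of the outbound and inbound left turn phases, and $R_{ai}$ is the duration of the common red (the time interval in each period during which both directions of artery $a$ are red). During the outbound left turn phase (length $\ell_{ai}$) the inbound direction is red; during the inbound left turn phase (length $\overline{\ell}_{ai}$) the outbound direction is red. Each left turn phase is adjacent to the common red interval, either immediately before or immediately after it. Hence in each period the outbound red is a single interval of length $R_{ai}+\overline{\ell}_{ai}$, and the inbound red is a single interval of length $R_{ai}+\ell_{ai}$. The four patterns and their binary encodings $(\delta_{ai},\overline{\delta}_{ai})$ are: Pattern 1, $(0,1)$: inbound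 left turn phase immediately before the common red, outbound left turn phase immediately after it. Pattern 2, $(1,0)$: outbound left turn phase immediately before the common red, inbound left turn phase immediately after it. Pattern 3, $(0,0)$: both left turn phases immediately after the common red. Pattern 4, $(1,1)$: both left turn phases immediately before the common red. Thus $\overline{\delta}_{ai}=1$ means the outbound red interval is [inbound left turn phase, then common red], and $\overline{\delta}_{ai}=0$ means it is [common red, then inbound left turn phase]. Junction. The signals $S_{mj}$ and $S_{ck}$ at junction $i$ have complementary common reds: the phase of the cross street takes place during the common red $R_m$ of the main street and vice versa, i.e. within each period the common red interval of $S_{ck}$ is exactly the complement of the common red interval of $S_{mj}$ (so $R_m+R_c=1$, and the common red of $S_{ck}$ starts when that of $S_{mj}$ ends). Intranode offset. $\Psi_{S_{mj},S_{ck}}^i$ is the time (in periods) between consecutive centers of the outbound reds of $S_{mj}$ and $S_{ck}$: the time from the center of an outbound red interval of $S_{mj}$ to the center of the next outbound red interval of $S_{ck}$, namely the one containing the common red interval of $S_{ck}$ that starts at the end of the common red interval of $S_{mj}$. *)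

theory Defs
  imports Complex_Main
begin

text \<open>
  Time is measured in signal periods, so all phases recur with period 1. Every phase is
  a half-open interval; the occurrences of a phase are indexed by the integers, occurrence
  \<open>n\<close> being occurrence \<open>0\<close> shifted by \<open>n\<close>. A left turn phase carries the index of the
  common red it is adjacent to. In the last two patterns both left turn phases lie on the
  same side of the common red and overlap; the common red does not include that overlap.
\<close>

datatype pattern = Pattern1 | Pattern2 | Pattern3 | Pattern4

text \<open>The outbound bit and the inbound bit.\<close>

fun encoding :: "pattern \<Rightarrow> nat \<times> nat" where
  "encoding Pattern1 = (0, 1)"
| "encoding Pattern2 = (1, 0)"
| "encoding Pattern3 = (0, 0)"
| "encoding Pattern4 = (1, 1)"

text \<open>
  \<open>out_left\<close> and \<open>in_left\<close> are the durations of the outbound and inbound left turn phases,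
  \<open>red_start\<close> is the time at which occurrence \<open>0\<close> of the common red starts.
\<close>

record signal =
  pattern :: pattern
  red_start :: real
  red_length :: real
  out_left :: real
  in_left :: real

definition valid_signal :: "signal \<Rightarrow> bool" where
  "valid_signal S \<longleftrightarrow> red_length S > 0 \<and> out_left S \<ge> 0 \<and> in_left S \<ge> 0"

definition common_red :: "signal \<Rightarrow> int \<Rightarrow> real set" where
  "common_red S n =
     {red_start S + of_int n ..< red_start S + of_int n + red_length S}"

definition before_red :: "signal \<Rightarrow> int \<Rightarrow> real \<Rightarrow> real set" where
  "before_red S n d = {red_start S + of_int n - d ..< red_start S + of_int n}"

definition after_red :: "signal \<Rightarrow> int \<Rightarrow> real \<Rightarrow> real set" where
  "after_red S n d =
     {red_start S + of_int n + red_length S ..< red_start S + of_int n + red_length S + d}"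

definition outbound_left_phase :: "signal \<Rightarrow> int \<Rightarrow> real set" where
  "outbound_left_phase S n =
     (case pattern S of
        Pattern1 \<Rightarrow> after_red S n (out_left S)
      | Pattern2 \<Rightarrow> before_red S n (out_left S)
      | Pattern3 \<Rightarrow> after_red S n (out_left S)
      | Pattern4 \<Rightarrow> before_red S n (out_left S))"

definition inbound_left_phase :: "signal \<Rightarrow> int \<Rightarrow> real set" where
  "inbound_left_phase S n =
     (case pattern S of
        Pattern1 \<Rightarrow> before_red S n (in_left S)
      | Pattern2 \<Rightarrow> after_red S n (in_left S)
      | Pattern3 \<Rightarrow> after_red S n (in_left S)
      | Pattern4 \<Rightarrow> before_red S n (in_left S))"

text \<open>Each direction is red during the common red and during the \<^emph>\<open>opposite\<close> left turn phase.\<close>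

definition outbound_red :: "signal \<Rightarrow> int \<Rightarrow> real set" where
  "outbound_red S n = common_red S n \<union> inbound_left_phase S n"

definition inbound_red :: "signal \<Rightarrow> int \<Rightarrow> real set" where
  "inbound_red S n = common_red S n \<union> outbound_left_phase S n"

text \<open>The midpoint of a bounded nonempty interval.\<close>

definition center :: "real set \<Rightarrow> real" where
  "center I = (Inf I + Sup I) / 2"

definition complementary_reds :: "signal \<Rightarrow> signal \<Rightarrow> bool" where
  "complementary_reds M C \<longleftrightarrow> (\<Union>n. common_red C n) = - (\<Union>n. common_red M n)"

text \<open>
  The time from the center of an outbound red of \<open>M\<close> to the center of the next outbound red
  of \<open>C\<close>, where the next one is the one containing the common red of \<open>C\<close> that starts at the
  end of the common red of \<open>M\<close>.
\<close>

definition intranode_offset :: "signal \<Rightarrow> signal \<Rightarrow> real" where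
  "intranode_offset M C =
     (THE d. \<exists>j k. Inf (common_red C k) = Sup (common_red M j) \<and>
                   d = center (outbound_red C k) - center (outbound_red M j))"

end

theory Submission
  imports Defs
begin

text \<open>
  A point lies in some common red of a signal exactly when its phase relative to the start of
  the red is less than the red length. Hence complementary reds force each red to start, modulo
  the period, where the other ends; going around once, the two lengths add up to an integer
  strictly between \<open>0\<close> and \<open>2\<close>, which is \<open>1\<close>. The outbound red extends the common red on one
  side by the inbound left turn phase, so its center is moved by half of that phase, earlier or
  later according to the inbound bit.
\<close>

lemma mem_common_reds_iff:
  "x \<in> (\<Union>n. common_red S n) \<longleftrightarrow> frac (x - red_start S) < red_length S"
proof
  assume "x \<in> (\<Union>n. common_red S n)"
  then obtain n where n: "real_of_int n \<le> x - red_start S"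
      "x - red_start S - real_of_int n < red_length S"
    unfolding common_red_def UN_iff atLeastLessThan_iff by (force simp: algebra_simps)
  from n(1) have "n \<le> \<lfloor>x - red_start S\<rfloor>"
    by (simp add: le_floor_iff)
  with n(2) show "frac (x - red_start S) < red_length S"
    unfolding frac_def by linarith
next
  assume "frac (x - red_start S) < red_length S"
  then have "x \<in> common_red S \<lfloor>x - red_start S\<rfloor>"
    unfolding common_red_def frac_def atLeastLessThan_iff by linarith
  then show "x \<in> (\<Union>n. common_red S n)"
    by blast
qed

lemma complementary_reds_iff:
  "complementary_reds M C \<longleftrightarrow>
     (\<forall>x. frac (x - red_start C) < red_length C \<longleftrightarrow> \<not> frac (x - red_start M) < red_length M)"
  unfolding complementary_reds_def set_eq_iff Compl_iff mem_common_reds_iff ..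

lemma complementary_reds_sym: "complementary_reds M C \<Longrightarrow> complementary_reds C M"
  unfolding complementary_reds_def by blast

text \<open>The start of a red of \<open>C\<close> is in no red of \<open>M\<close>, so its phase
  relative to \<open>M\<close> is at least \<open>red_length M\<close>; phases are below 1.\<close>

lemma complementary_reds_length_less_1:
  assumes "complementary_reds M C" "red_length C > 0"
  shows "red_length M < 1"
proof -
  have "\<not> frac (red_start C - red_start M) < red_length M"
    using spec[OF assms(1)[unfolded complementary_reds_iff], of "red_start C"] assms(2) by simp
  then show ?thesis
    using frac_lt_1[of "red_start C - red_start M"] by linarith
qed

lemma complementary_reds_adjacent:
  assumes compl: "complementary_reds M C"
    and pos: "red_length M > 0" "red_length C > 0"
  shows "red_start M + red_length M - red_start C \<in> \<int>"
proof (rule ccontr)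
  define e where "e = frac (red_start M + red_length M - red_start C)"
  \<comment> \<open>Otherwise the end of a red of \<open>M\<close> is interior to a red of \<open>C\<close>, so slightly
    earlier points are red for both.\<close>
  assume "\<not> ?thesis"
  then have e: "0 < e" "e < 1"
    by (auto simp: e_def frac_gt_0_iff frac_lt_1)
  \<comment> \<open>Stepping back by t \<le> \<open>e\<close> does not pass the start of that red of
    \<open>C\<close>, and by t \<le> \<open>red_length M\<close> not the start of the red of
    \<open>M\<close>. So neither phase of \<open>x\<close> below wraps around.\<close>
  define t where "t = min e (red_length M)"
  have t: "0 < t" "t \<le> e" "t \<le> red_length M"
    using e pos by (auto simp: t_def)
  have R: "red_length M < 1"
    using complementary_reds_length_less_1[OF compl pos(2)] .
  \<comment> \<open>Reds of \<open>M\<close> are half-open and shorter than the period, so the end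
    of one lies in none of them. By complementarity it lies in a red of \<open>C\<close>, at phase
    \<open>e\<close>.\<close>
  have "frac (red_start M + red_length M - red_start M) = red_length M"
    using R pos by (simp add: frac_eq)
  then have "e < red_length C"
    using compl unfolding complementary_reds_iff e_def
    by (auto dest: spec[of _ "red_start M + red_length M"])
  define x where "x = red_start M + red_length M - t"
  have "frac (x - red_start M) = red_length M - t"
    using t R by (simp add: x_def frac_eq)
  moreover have "frac (x - red_start C) = e - t"
    unfolding frac_unique_iff
  proof (intro conjI)
    have "x - red_start C - (e - t) = of_int \<lfloor>red_start M + red_length M - red_start C\<rfloor>"
      by (simp add: x_def e_def frac_def)
    then show "x - red_start C - (e - t) \<in> \<int>"
      by simp
  qed (use t e in auto)
  ultimately show False
    using compl t \<open>e < red_length C\<close> unfolding complementary_reds_iff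
    by (auto dest: spec[of _ x])
qed

lemma complementary_reds_lengths:
  assumes compl: "complementary_reds M C"
    and pos: "red_length M > 0" "red_length C > 0"
  shows "red_length M + red_length C = 1"
proof -
  note compl' = complementary_reds_sym[OF compl]
  \<comment> \<open>The starts cancel, leaving the sum of the lengths.\<close>
  have "(red_start M + red_length M - red_start C) + (red_start C + red_length C - red_start M) \<in> \<int>"
    using complementary_reds_adjacent[OF compl pos]
      complementary_reds_adjacent[OF compl' pos(2,1)] by (rule Ints_add)
  then obtain k :: int where "red_length M + red_length C = of_int k"
    by (auto elim: Ints_cases)
  moreover have "red_length M < 1" "red_length C < 1"
    using complementary_reds_length_less_1 compl compl' pos by blast+
  ultimately have "0 < real_of_int k" "real_of_int k < 2"
    using pos by linarith+
  then have "k = 1"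
    by linarith
  with \<open>red_length M + red_length C = of_int k\<close> show ?thesis
    by simp
qed

lemma center_atLeastLessThan: "a < b \<Longrightarrow> center {a..<b} = (a + b) / 2"
  by (simp add: center_def)

lemma center_outbound_red:
  assumes "valid_signal S"
  shows "center (outbound_red S n) =
    red_start S + of_int n + red_length S / 2
      - (2 * real (snd (encoding (pattern S))) - 1) * in_left S / 2"
proof -
  let ?a = "red_start S + of_int n" and ?R = "red_length S" and ?l = "in_left S"
  have pos: "?R > 0" "?l \<ge> 0"
    using assms by (auto simp: valid_signal_def)
  \<comment> \<open>The two pieces share an endpoint, so they merge into one interval, also when the
    left turn phase is empty.\<close>
  have "outbound_red S n = (if snd (encoding (pattern S)) = 1
      then {?a - ?l ..< ?a + ?R} else {?a ..< ?a + ?R + ?l})"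
    using pos
    by (cases "pattern S")
      (auto simp: outbound_red_def inbound_left_phase_def common_red_def before_red_def
        after_red_def)
  then show ?thesis
    using pos by (cases "pattern S") (simp_all add: center_atLeastLessThan field_simps)
qed

theorem theorem1:
  fixes M C :: signal
    and p\<^sub>m p\<^sub>c :: pattern
    and \<delta>\<^sub>m \<delta>bar\<^sub>m \<delta>\<^sub>c \<delta>bar\<^sub>c :: nat
  assumes "valid_signal M" and "valid_signal C"
    and "complementary_reds M C"
    and "pattern M = p\<^sub>m" and "encoding p\<^sub>m = (\<delta>\<^sub>m, \<delta>bar\<^sub>m)"
    and "pattern C = p\<^sub>c" and "encoding p\<^sub>c = (\<delta>\<^sub>c, \<delta>bar\<^sub>c)"
  shows "intranode_offset M C =
    1 / 2 - 1 / 2 * ((2 * real \<delta>bar\<^sub>c - 1) * in_left C - (2 * real \<delta>bar\<^sub>m - 1) * in_left M)"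
proof -
  let ?d = "1 / 2 - 1 / 2 * ((2 * real \<delta>bar\<^sub>c - 1) * in_left C - (2 * real \<delta>bar\<^sub>m - 1) * in_left M)"
  have pos: "red_length M > 0" "red_length C > 0"
    using assms(1,2) by (auto simp: valid_signal_def)
  have sum: "red_length M + red_length C = 1"
    using complementary_reds_lengths[OF assms(3) pos] .
  have adjacent_iff: "Inf (common_red C k) = Sup (common_red M j) \<longleftrightarrow>
      red_start C + of_int k = red_start M + of_int j + red_length M" for j k
    using pos by (simp add: common_red_def)
  \<comment> \<open>The centers of adjacent common reds are half the total length apart, which is
    1/2; the rest is the two shifts. The value is the same for all adjacent pairs, which gives the
    uniqueness that \<open>THE\<close> needs.\<close>
  have offset: "center (outbound_red C k) - center (outbound_red M j) = ?d"
    if "red_start C + of_int k = red_start M + of_int j + red_length M" for j k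
    using that sum assms(4-7)
    by (simp add: center_outbound_red[OF assms(1)] center_outbound_red[OF assms(2)] field_simps)
  \<comment> \<open>Existence: some red of \<open>C\<close> starts where occurrence 0 of the red of
    \<open>M\<close> ends.\<close>
  obtain k :: int where "red_start M + red_length M - red_start C = of_int k"
    using complementary_reds_adjacent[OF assms(3) pos] by (auto elim: Ints_cases)
  then have k: "red_start C + of_int k = red_start M + of_int 0 + red_length M"
    by simp
  show ?thesis
    unfolding intranode_offset_def adjacent_iff
  proof (rule the_equality)
    show "\<exists>j k. red_start C + of_int k = red_start M + of_int j + red_length M \<and>
        ?d = center (outbound_red C k) - center (outbound_red M j)"
      using k offset[OF k] by (intro exI[of _ 0] exI[of _ k]) simp
  qed (auto simp: offset)
qed

end
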